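(* Let $(A,\rhd,\lhd,\mathfrak{B},P)$ be a skew-symmetric Rota-Baxter Frobenius dialgebra of weight $\lambda\neq 0$. Let $\varphi_{\mathfrak{B}}:A\to A^*$ be the linear isomorphism $\langle\varphi_{\mathfrak{B}}(x),y\rangle=\mathfrak{B}(x,y)$ and let $r\in A\otimes A$ be the 2-tensor form of $P\circ\varphi_{\mathfrak{B}}^{-1}$, i.e. $\langle r,a^*\otimes b^*\rangle=\langle(P\circ\varphi_{\mathfrak{B}}^{-1})(a^* ),b^*\rangle$ for all $a^*,b^*\in A^*$. Then $(A,\rhd,\lhd,\delta_{\rhd,r},\delta_{\lhd,r})$ is a factorizable bi-dialgebra, where for $x\in A$ $$\delta_{\rhd,r}(x)=\big(R_{\star}(x)\otimes\mathrm{id}+\mathrm{id}\otimes L_{\lhd}(x)\big)r,\qquad \delta_{\lhd,r}(x)=\big(R_{\rhd}(x)\otimes\mathrm{id}-\mathrm{id}\otimes L_{\star}(x)\big)r.$$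
   Context: All vector spaces and algebras are finite-dimensional over a field $\mathbb F$ of characteristic $0$; algebras are not assumed unital. Notation: $x\star y=x\rhd y-x\lhd y$; $L_\diamond(x)y=x\diamond y=R_\diamond(y)x$; $\tau(x\otimes y)=y\otimes x$. **Dialgebra.** $(A,\rhd,\lhd)$ where $\rhd,\lhd$ are associative bilinear products with $(x\lhd y)\lhd z=x\lhd(y\rhd z)$, $(x\rhd y)\lhd z=x\rhd(y\lhd z)$, $(x\lhd y)\rhd z=x\rhd(y\rhd z)$. A bilinear form $\mathfrak{B}$ on it is invariant if $\mathfrak{B}(x\rhd y,z)=\mathfrak{B}(x,y\rhd z-y\lhd z)$ and $\mathfrak{B}(x\lhd y,z)=\mathfrak{B}(x,y\rhd z)$. A skew-symmetric Frobenius dialgebra is a dialgebra with a nondegenerate skew-symmetric invariant bilinear form. **Rota-Baxter.** A Rota-Baxter operator of weight $\lambda\in\mathbb F$ on a dialgebra is a linear map $P:A\to A$ with $P(x)\diamond P(y)=P(P(x)\diamond y+x\diamond P(y)+\lambda\,x\diamond y)$ for $\diamond\in\{\rhd,\lhd\}$ and all $x,y$. A skew-symmetric Rota-Baxter Frobenius dialgebra of weight $\lambda$ is $(A,\rhd,\lhd,\mathfrak{B},P)$ with $(A,\rhd,\lhd,\mathfrak{B})$ a skew-symmetric Frobenius dialgebra, $P$ a Rota-Baxter operator of weight $\lambda$ on $(A,\rhd,\lhd)$, and $\mathfrak{B}(P(x),y)+\mathfrak{B}(x,P(y))+\lambda\mathfrak{B}(x,y)=0$ for all $x,y$. **Co-dialgebra.**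 $(A,\delta_{\rhd},\delta_{\lhd})$ with $\delta_{\rhd},\delta_{\lhd}:A\to A\otimes A$ linear and coassociative with $(\mathrm{id}\otimes\delta_{\lhd})\delta_{\lhd}=(\mathrm{id}\otimes\delta_{\rhd})\delta_{\lhd}$, $(\delta_{\rhd}\otimes\mathrm{id})\delta_{\lhd}=(\mathrm{id}\otimes\delta_{\lhd})\delta_{\rhd}$, $(\delta_{\lhd}\otimes\mathrm{id})\delta_{\rhd}=(\delta_{\rhd}\otimes\mathrm{id})\delta_{\rhd}$. **Bi-dialgebra.** $(A,\rhd,\lhd,\delta_{\rhd},\delta_{\lhd})$, a dialgebra and a co-dialgebra such that, with $\delta_\star=\delta_{\rhd}-\delta_{\lhd}$, for all $x,y\in A$: $(\mathrm{id}\otimes L_{\lhd}(x))\delta_{\lhd}(y)=(R_{\rhd}(y)\otimes\mathrm{id})\delta_{\rhd}(x)$; $(L_{\lhd}(x)\otimes\mathrm{id})\delta_{\rhd}(y)=(\mathrm{id}\otimes L_{\lhd}(y))\tau\delta_{\rhd}(x)$; $(R_{\rhd}(x)\otimes\mathrm{id})\tau\delta_{\lhd}(y)=(\mathrm{id}\otimes R_{\rhd}(y))\delta_{\lhd}(x)$; $\delta_{\rhd}(x\rhd y)=(\mathrm{id}\otimes L_{\rhd}(x))\delta_{\rhd}(y)-(R_{\star}(y)\otimes\mathrm{id})\delta_{\star}(x)$; $\delta_{\rhd}(x\lhd y)=(\mathrm{id}\otimes L_{\lhd}(x))\delta_{\star}(y)+(R_{\lhd}(y)\otimes\mathrm{id})\delta_{\rhd}(x)$;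 $\delta_{\lhd}(x\rhd y)=(\mathrm{id}\otimes L_{\star}(x))\delta_{\lhd}(y)+(R_{\rhd}(y)\otimes\mathrm{id})\delta_{\lhd}(x)$; $\delta_{\lhd}(x\lhd y)=(R_{\lhd}(y)\otimes\mathrm{id})\delta_{\lhd}(x)-(\mathrm{id}\otimes L_{\star}(x))\delta_{\star}(y)$; $(L_{\star}(x)\otimes\mathrm{id})\delta_{\rhd}(y)+(\mathrm{id}\otimes L_{\lhd}(y))\tau\delta_{\lhd}(x)=(R_{\star}(y)\otimes\mathrm{id})\tau\delta_{\star}(x)+(\mathrm{id}\otimes R_{\lhd}(x))\delta_{\rhd}(y)$; $(R_{\lhd}(x)\otimes\mathrm{id})\tau\delta_{\lhd}(y)+(\mathrm{id}\otimes R_{\rhd}(y))\delta_{\star}(x)=(L_{\star}(y)\otimes\mathrm{id})\delta_{\star}(x)+(\mathrm{id}\otimes L_{\rhd}(x))\tau\delta_{\lhd}(y)$. **Factorizable.** $r=\sum_i a_i\otimes b_i\in A\otimes A$ solves the diassociative Yang-Baxter equation (DAYBE) if $\sum_{i,j}\big(a_i\otimes a_j\otimes b_i\rhd b_j-a_j\otimes a_i\lhd b_j\otimes b_i-a_i\star a_j\otimes b_i\otimes b_j\big)=0$; $s\in A\otimes A$ is invariant if $(R_{\star}(x)\otimes\mathrm{id}+\mathrm{id}\otimes L_{\lhd}(x))s=0=(R_{\rhd}(x)\otimes\mathrm{id}-\mathrm{id}\otimes L_{\star}(x))s$ for all $x\in A$. If $r$ solves the DAYBE and its skew-symmetric part $\alpha=r-\tau(r)$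 is invariant, the bi-dialgebra $(A,\rhd,\lhd,\delta_{\rhd,r},\delta_{\lhd,r})$ is called quasi-triangular; it is factorizable if in addition $\widetilde\alpha:A^*\to A$, $\langle\widetilde\alpha(u^* ),v^*\rangle=\langle\alpha,u^*\otimes v^*\rangle$, is a linear isomorphism. *)

theory Defs
  imports Complex_Main "HOL-Library.Function_Algebras"
begin

text \<open>
  Vector spaces are given by a scalar multiplication \<open>s\<close> on the whole type \<open>'a\<close>.
  Sums, differences and \<open>0\<close> of functions are pointwise (\<open>Function_Algebras\<close>).
\<close>

section \<open>Duals and tensor powers\<close>

definition dual_space :: "('f::field \<Rightarrow> 'a::ab_group_add \<Rightarrow> 'a) \<Rightarrow> ('a \<Rightarrow> 'f) set" where
  "dual_space s = {u. Vector_Spaces.linear s (*) u}"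

text \<open>
  For finite-dimensional \<open>A\<close>, the tensor powers \<open>A \<otimes> A\<close> and \<open>A \<otimes> A \<otimes> A\<close> are realised as the
  bilinear and trilinear forms on \<open>A\<^sup>*\<close>; the value of \<open>t\<close> at \<open>u, v\<close> is the pairing
  \<open>\<langle>t, u \<otimes> v\<rangle>\<close>. Since \<open>A\<^sup>*\<close> is a subset of the type \<open>'a \<Rightarrow> 'f\<close>, a tensor takes the value \<open>0\<close>
  when some argument lies outside \<open>A\<^sup>*\<close>, so that equality of tensors is equality of functions.
\<close>

type_synonym ('a, 'f) tensor2 = "('a \<Rightarrow> 'f) \<Rightarrow> ('a \<Rightarrow> 'f) \<Rightarrow> 'f"
type_synonym ('a, 'f) tensor3 = "('a \<Rightarrow> 'f) \<Rightarrow> ('a \<Rightarrow> 'f) \<Rightarrow> ('a \<Rightarrow> 'f) \<Rightarrow> 'f"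

definition restrict2 ::
  "('f::field \<Rightarrow> 'a::ab_group_add \<Rightarrow> 'a) \<Rightarrow> ('a, 'f) tensor2 \<Rightarrow> ('a, 'f) tensor2" where
  "restrict2 s t = (\<lambda>u v. if u \<in> dual_space s \<and> v \<in> dual_space s then t u v else 0)"

definition restrict3 ::
  "('f::field \<Rightarrow> 'a::ab_group_add \<Rightarrow> 'a) \<Rightarrow> ('a, 'f) tensor3 \<Rightarrow> ('a, 'f) tensor3" where
  "restrict3 s t = (\<lambda>u v w.
     if u \<in> dual_space s \<and> v \<in> dual_space s \<and> w \<in> dual_space s then t u v w else 0)"

definition functional_on_dual ::
  "('f::field \<Rightarrow> 'a::ab_group_add \<Rightarrow> 'a) \<Rightarrow> (('a \<Rightarrow> 'f) \<Rightarrow> 'f) \<Rightarrow> bool" where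
  "functional_on_dual s h \<longleftrightarrow>
     (\<forall>u\<in>dual_space s. \<forall>v\<in>dual_space s. h (u + v) = h u + h v) \<and>
     (\<forall>c. \<forall>u\<in>dual_space s. h (\<lambda>x. c * u x) = c * h u)"

definition tensor2_space :: "('f::field \<Rightarrow> 'a::ab_group_add \<Rightarrow> 'a) \<Rightarrow> ('a, 'f) tensor2 set" where
  "tensor2_space s = {t. restrict2 s t = t \<and>
     (\<forall>u\<in>dual_space s. functional_on_dual s (\<lambda>v. t u v)) \<and>
     (\<forall>v\<in>dual_space s. functional_on_dual s (\<lambda>u. t u v))}"

definition tensor2_scale :: "'f::field \<Rightarrow> ('a, 'f) tensor2 \<Rightarrow> ('a, 'f) tensor2" where
  "tensor2_scale c t = (\<lambda>u v. c * t u v)"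

definition pure2 ::
  "('f::field \<Rightarrow> 'a::ab_group_add \<Rightarrow> 'a) \<Rightarrow> 'a \<Rightarrow> 'a \<Rightarrow> ('a, 'f) tensor2" where
  "pure2 s x y = restrict2 s (\<lambda>u v. u x * v y)"

definition pure3 ::
  "('f::field \<Rightarrow> 'a::ab_group_add \<Rightarrow> 'a) \<Rightarrow> 'a \<Rightarrow> 'a \<Rightarrow> 'a \<Rightarrow> ('a, 'f) tensor3" where
  "pure3 s x y z = restrict3 s (\<lambda>u v w. u x * v y * w z)"

text \<open>The maps \<open>f \<otimes> g\<close>, \<open>\<tau>\<close>, \<open>d \<otimes> id\<close> and \<open>id \<otimes> d\<close> on tensors, for linear \<open>f\<close>, \<open>g\<close>, \<open>d\<close>;
  the lemmas \<open>tensor_map_pure2\<close>, \<open>flip_pure2\<close>, \<open>tensor_left_pure2\<close> and \<open>tensor_right_pure2\<close>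
  below give their values on pure tensors.\<close>

definition tensor_map :: "('f::field \<Rightarrow> 'a::ab_group_add \<Rightarrow> 'a) \<Rightarrow>
    ('a \<Rightarrow> 'a) \<Rightarrow> ('a \<Rightarrow> 'a) \<Rightarrow> ('a, 'f) tensor2 \<Rightarrow> ('a, 'f) tensor2" where
  "tensor_map s f g t = restrict2 s (\<lambda>u v. t (u \<circ> f) (v \<circ> g))"

definition flip :: "('a, 'f) tensor2 \<Rightarrow> ('a, 'f) tensor2" where
  "flip t = (\<lambda>u v. t v u)"

definition tensor_left :: "('f::field \<Rightarrow> 'a::ab_group_add \<Rightarrow> 'a) \<Rightarrow>
    ('a \<Rightarrow> ('a, 'f) tensor2) \<Rightarrow> ('a, 'f) tensor2 \<Rightarrow> ('a, 'f) tensor3" where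
  "tensor_left s d t = restrict3 s (\<lambda>u v w. t (\<lambda>x. d x u v) w)"

definition tensor_right :: "('f::field \<Rightarrow> 'a::ab_group_add \<Rightarrow> 'a) \<Rightarrow>
    ('a \<Rightarrow> ('a, 'f) tensor2) \<Rightarrow> ('a, 'f) tensor2 \<Rightarrow> ('a, 'f) tensor3" where
  "tensor_right s d t = restrict3 s (\<lambda>u v w. t u (\<lambda>x. d x v w))"

text \<open>The 2-tensor form of a linear map \<open>T : A\<^sup>* \<rightarrow> A\<close>: \<open>\<langle>r, u \<otimes> v\<rangle> = \<langle>T u, v\<rangle>\<close>.\<close>

definition tensor_of_map :: "('f::field \<Rightarrow> 'a::ab_group_add \<Rightarrow> 'a) \<Rightarrow>
    (('a \<Rightarrow> 'f) \<Rightarrow> 'a) \<Rightarrow> ('a, 'f) tensor2" where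
  "tensor_of_map s T = restrict2 s (\<lambda>u v. v (T u))"

text \<open>Conversely, the map \<open>A\<^sup>* \<rightarrow> A\<close> of a tensor: \<open>\<langle>T u, v\<rangle> = \<langle>t, u \<otimes> v\<rangle>\<close> for all \<open>v\<close>.\<close>

definition map_of_tensor :: "('f::field \<Rightarrow> 'a::ab_group_add \<Rightarrow> 'a) \<Rightarrow>
    ('a, 'f) tensor2 \<Rightarrow> ('a \<Rightarrow> 'f) \<Rightarrow> 'a" where
  "map_of_tensor s t u = (THE x. \<forall>v\<in>dual_space s. v x = t u v)"

definition dual_linear_iso :: "('f::field \<Rightarrow> 'a::ab_group_add \<Rightarrow> 'a) \<Rightarrow>
    (('a \<Rightarrow> 'f) \<Rightarrow> 'a) \<Rightarrow> bool" where
  "dual_linear_iso s T \<longleftrightarrow>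
     (\<forall>u\<in>dual_space s. \<forall>v\<in>dual_space s. T (u + v) = T u + T v) \<and>
     (\<forall>c. \<forall>u\<in>dual_space s. T (\<lambda>x. c * u x) = s c (T u)) \<and>
     bij_betw T (dual_space s) UNIV"

section \<open>Dialgebras\<close>

definition bilinear_map :: "('f::field \<Rightarrow> 'a::ab_group_add \<Rightarrow> 'a) \<Rightarrow>
    ('f \<Rightarrow> 'b::ab_group_add \<Rightarrow> 'b) \<Rightarrow> ('a \<Rightarrow> 'a \<Rightarrow> 'b) \<Rightarrow> bool" where
  "bilinear_map s s' m \<longleftrightarrow>
     (\<forall>x. Vector_Spaces.linear s s' (\<lambda>y. m x y)) \<and>
     (\<forall>y. Vector_Spaces.linear s s' (\<lambda>x. m x y))"

definition Lmul :: "('a \<Rightarrow> 'a \<Rightarrow> 'a) \<Rightarrow> 'a \<Rightarrow> 'a \<Rightarrow> 'a" where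
  "Lmul m x = (\<lambda>y. m x y)"

definition Rmul :: "('a \<Rightarrow> 'a \<Rightarrow> 'a) \<Rightarrow> 'a \<Rightarrow> 'a \<Rightarrow> 'a" where
  "Rmul m x = (\<lambda>y. m y x)"

definition star ::
  "('a \<Rightarrow> 'a \<Rightarrow> 'a::ab_group_add) \<Rightarrow> ('a \<Rightarrow> 'a \<Rightarrow> 'a) \<Rightarrow> 'a \<Rightarrow> 'a \<Rightarrow> 'a" where
  "star rhd lhd = (\<lambda>x y. rhd x y - lhd x y)"

definition dialgebra :: "('f::field \<Rightarrow> 'a::ab_group_add \<Rightarrow> 'a) \<Rightarrow>
    ('a \<Rightarrow> 'a \<Rightarrow> 'a) \<Rightarrow> ('a \<Rightarrow> 'a \<Rightarrow> 'a) \<Rightarrow> bool" where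
  "dialgebra s rhd lhd \<longleftrightarrow>
     bilinear_map s s rhd \<and> bilinear_map s s lhd \<and>
     (\<forall>x y z. rhd (rhd x y) z = rhd x (rhd y z)) \<and>
     (\<forall>x y z. lhd (lhd x y) z = lhd x (lhd y z)) \<and>
     (\<forall>x y z. lhd (lhd x y) z = lhd x (rhd y z)) \<and>
     (\<forall>x y z. lhd (rhd x y) z = rhd x (lhd y z)) \<and>
     (\<forall>x y z. rhd (lhd x y) z = rhd x (rhd y z))"

definition invariant_form :: "('a \<Rightarrow> 'a \<Rightarrow> 'a::ab_group_add) \<Rightarrow> ('a \<Rightarrow> 'a \<Rightarrow> 'a) \<Rightarrow>
    ('a \<Rightarrow> 'a \<Rightarrow> 'f) \<Rightarrow> bool" where
  "invariant_form rhd lhd B \<longleftrightarrow>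
     (\<forall>x y z. B (rhd x y) z = B x (rhd y z - lhd y z)) \<and>
     (\<forall>x y z. B (lhd x y) z = B x (rhd y z))"

definition nondegenerate_form :: "('a::ab_group_add \<Rightarrow> 'a \<Rightarrow> 'f::field) \<Rightarrow> bool" where
  "nondegenerate_form B \<longleftrightarrow>
     (\<forall>x. (\<forall>y. B x y = 0) \<longrightarrow> x = 0) \<and> (\<forall>y. (\<forall>x. B x y = 0) \<longrightarrow> y = 0)"

definition skew_Frobenius_dialgebra :: "('f::field \<Rightarrow> 'a::ab_group_add \<Rightarrow> 'a) \<Rightarrow>
    ('a \<Rightarrow> 'a \<Rightarrow> 'a) \<Rightarrow> ('a \<Rightarrow> 'a \<Rightarrow> 'a) \<Rightarrow> ('a \<Rightarrow> 'a \<Rightarrow> 'f) \<Rightarrow> bool" where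
  "skew_Frobenius_dialgebra s rhd lhd B \<longleftrightarrow>
     dialgebra s rhd lhd \<and> bilinear_map s (*) B \<and> nondegenerate_form B \<and>
     (\<forall>x y. B x y = - B y x) \<and> invariant_form rhd lhd B"

definition Rota_Baxter_operator :: "('f::field \<Rightarrow> 'a::ab_group_add \<Rightarrow> 'a) \<Rightarrow>
    ('a \<Rightarrow> 'a \<Rightarrow> 'a) \<Rightarrow> ('a \<Rightarrow> 'a \<Rightarrow> 'a) \<Rightarrow> 'f \<Rightarrow> ('a \<Rightarrow> 'a) \<Rightarrow> bool" where
  "Rota_Baxter_operator s rhd lhd lam P \<longleftrightarrow>
     Vector_Spaces.linear s s P \<and>
     (\<forall>m\<in>{rhd, lhd}. \<forall>x y. m (P x) (P y) = P (m (P x) y + m x (P y) + s lam (m x y)))"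

definition skew_Rota_Baxter_Frobenius_dialgebra ::
  "('f::field \<Rightarrow> 'a::ab_group_add \<Rightarrow> 'a) \<Rightarrow> ('a \<Rightarrow> 'a \<Rightarrow> 'a) \<Rightarrow> ('a \<Rightarrow> 'a \<Rightarrow> 'a) \<Rightarrow>
    ('a \<Rightarrow> 'a \<Rightarrow> 'f) \<Rightarrow> 'f \<Rightarrow> ('a \<Rightarrow> 'a) \<Rightarrow> bool" where
  "skew_Rota_Baxter_Frobenius_dialgebra s rhd lhd B lam P \<longleftrightarrow>
     skew_Frobenius_dialgebra s rhd lhd B \<and> Rota_Baxter_operator s rhd lhd lam P \<and>
     (\<forall>x y. B (P x) y + B x (P y) + lam * B x y = 0)"

text \<open>The map \<open>A \<rightarrow> A\<^sup>*\<close> induced by a form.\<close>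

definition form_map :: "('a \<Rightarrow> 'a \<Rightarrow> 'f) \<Rightarrow> 'a \<Rightarrow> ('a \<Rightarrow> 'f)" where
  "form_map B x = (\<lambda>y. B x y)"

section \<open>Bi-dialgebras\<close>

definition codialgebra :: "('f::field \<Rightarrow> 'a::ab_group_add \<Rightarrow> 'a) \<Rightarrow>
    ('a \<Rightarrow> ('a, 'f) tensor2) \<Rightarrow> ('a \<Rightarrow> ('a, 'f) tensor2) \<Rightarrow> bool" where
  "codialgebra s dr dl \<longleftrightarrow>
     (\<forall>x. dr x \<in> tensor2_space s) \<and> (\<forall>x. dl x \<in> tensor2_space s) \<and>
     Vector_Spaces.linear s tensor2_scale dr \<and> Vector_Spaces.linear s tensor2_scale dl \<and>
     (\<forall>x. tensor_left s dr (dr x) = tensor_right s dr (dr x)) \<and>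
     (\<forall>x. tensor_left s dl (dl x) = tensor_right s dl (dl x)) \<and>
     (\<forall>x. tensor_right s dl (dl x) = tensor_right s dr (dl x)) \<and>
     (\<forall>x. tensor_left s dr (dl x) = tensor_right s dl (dr x)) \<and>
     (\<forall>x. tensor_left s dl (dr x) = tensor_left s dr (dr x))"

definition bidialgebra :: "('f::field \<Rightarrow> 'a::ab_group_add \<Rightarrow> 'a) \<Rightarrow>
    ('a \<Rightarrow> 'a \<Rightarrow> 'a) \<Rightarrow> ('a \<Rightarrow> 'a \<Rightarrow> 'a) \<Rightarrow>
    ('a \<Rightarrow> ('a, 'f) tensor2) \<Rightarrow> ('a \<Rightarrow> ('a, 'f) tensor2) \<Rightarrow> bool" where
  "bidialgebra s rhd lhd dr dl \<longleftrightarrow>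
     dialgebra s rhd lhd \<and> codialgebra s dr dl \<and>
     (let st = star rhd lhd; ds = dr - dl in \<forall>x y.
        tensor_map s id (Lmul lhd x) (dl y) = tensor_map s (Rmul rhd y) id (dr x) \<and>
        tensor_map s (Lmul lhd x) id (dr y) = tensor_map s id (Lmul lhd y) (flip (dr x)) \<and>
        tensor_map s (Rmul rhd x) id (flip (dl y)) = tensor_map s id (Rmul rhd y) (dl x) \<and>
        dr (rhd x y) = tensor_map s id (Lmul rhd x) (dr y) - tensor_map s (Rmul st y) id (ds x) \<and>
        dr (lhd x y) = tensor_map s id (Lmul lhd x) (ds y) + tensor_map s (Rmul lhd y) id (dr x) \<and>
        dl (rhd x y) = tensor_map s id (Lmul st x) (dl y) + tensor_map s (Rmul rhd y) id (dl x) \<and>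
        dl (lhd x y) = tensor_map s (Rmul lhd y) id (dl x) - tensor_map s id (Lmul st x) (ds y) \<and>
        tensor_map s (Lmul st x) id (dr y) + tensor_map s id (Lmul lhd y) (flip (dl x)) =
          tensor_map s (Rmul st y) id (flip (ds x)) + tensor_map s id (Rmul lhd x) (dr y) \<and>
        tensor_map s (Rmul lhd x) id (flip (dl y)) + tensor_map s id (Rmul rhd y) (ds x) =
          tensor_map s (Lmul st y) id (ds x) + tensor_map s id (Lmul rhd x) (flip (dl y)))"

text \<open>The left-hand side of the diassociative Yang-Baxter equation for
  \<open>r = (\<Sum>i<n. a i \<otimes> b i)\<close>. It depends only on \<open>r\<close> (\<open>daybe_lhs_unique\<close> below), and every
  tensor has such an expression (\<open>tensor2_space_pure2_sum\<close>).\<close>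

definition daybe_lhs :: "('f::field \<Rightarrow> 'a::ab_group_add \<Rightarrow> 'a) \<Rightarrow>
    ('a \<Rightarrow> 'a \<Rightarrow> 'a) \<Rightarrow> ('a \<Rightarrow> 'a \<Rightarrow> 'a) \<Rightarrow>
    nat \<Rightarrow> (nat \<Rightarrow> 'a) \<Rightarrow> (nat \<Rightarrow> 'a) \<Rightarrow> ('a, 'f) tensor3" where
  "daybe_lhs s rhd lhd n a b = (\<Sum>i<n. \<Sum>j<n.
       pure3 s (a i) (a j) (rhd (b i) (b j))
     - pure3 s (a j) (lhd (a i) (b j)) (b i)
     - pure3 s (star rhd lhd (a i) (a j)) (b i) (b j))"

definition solves_daybe :: "('f::field \<Rightarrow> 'a::ab_group_add \<Rightarrow> 'a) \<Rightarrow>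
    ('a \<Rightarrow> 'a \<Rightarrow> 'a) \<Rightarrow> ('a \<Rightarrow> 'a \<Rightarrow> 'a) \<Rightarrow> ('a, 'f) tensor2 \<Rightarrow> bool" where
  "solves_daybe s rhd lhd r \<longleftrightarrow>
     (\<exists>n a b. r = (\<Sum>i<n. pure2 s (a i) (b i)) \<and> daybe_lhs s rhd lhd n a b = 0)"

definition coproduct_rhd :: "('f::field \<Rightarrow> 'a::ab_group_add \<Rightarrow> 'a) \<Rightarrow>
    ('a \<Rightarrow> 'a \<Rightarrow> 'a) \<Rightarrow> ('a \<Rightarrow> 'a \<Rightarrow> 'a) \<Rightarrow> ('a, 'f) tensor2 \<Rightarrow> 'a \<Rightarrow> ('a, 'f) tensor2" where
  "coproduct_rhd s rhd lhd r x =
     tensor_map s (Rmul (star rhd lhd) x) id r + tensor_map s id (Lmul lhd x) r"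

definition coproduct_lhd :: "('f::field \<Rightarrow> 'a::ab_group_add \<Rightarrow> 'a) \<Rightarrow>
    ('a \<Rightarrow> 'a \<Rightarrow> 'a) \<Rightarrow> ('a \<Rightarrow> 'a \<Rightarrow> 'a) \<Rightarrow> ('a, 'f) tensor2 \<Rightarrow> 'a \<Rightarrow> ('a, 'f) tensor2" where
  "coproduct_lhd s rhd lhd r x =
     tensor_map s (Rmul rhd x) id r - tensor_map s id (Lmul (star rhd lhd) x) r"

definition invariant_tensor :: "('f::field \<Rightarrow> 'a::ab_group_add \<Rightarrow> 'a) \<Rightarrow>
    ('a \<Rightarrow> 'a \<Rightarrow> 'a) \<Rightarrow> ('a \<Rightarrow> 'a \<Rightarrow> 'a) \<Rightarrow> ('a, 'f) tensor2 \<Rightarrow> bool" where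
  "invariant_tensor s rhd lhd t \<longleftrightarrow>
     (\<forall>x. tensor_map s (Rmul (star rhd lhd) x) id t + tensor_map s id (Lmul lhd x) t = 0 \<and>
          tensor_map s (Rmul rhd x) id t - tensor_map s id (Lmul (star rhd lhd) x) t = 0)"

text \<open>These are properties of the bi-dialgebra whose coproducts are determined by \<open>r\<close>.\<close>

definition quasi_triangular_bidialgebra :: "('f::field \<Rightarrow> 'a::ab_group_add \<Rightarrow> 'a) \<Rightarrow>
    ('a \<Rightarrow> 'a \<Rightarrow> 'a) \<Rightarrow> ('a \<Rightarrow> 'a \<Rightarrow> 'a) \<Rightarrow> ('a, 'f) tensor2 \<Rightarrow> bool" where
  "quasi_triangular_bidialgebra s rhd lhd r \<longleftrightarrow>
     r \<in> tensor2_space s \<and>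
     bidialgebra s rhd lhd (coproduct_rhd s rhd lhd r) (coproduct_lhd s rhd lhd r) \<and>
     solves_daybe s rhd lhd r \<and> invariant_tensor s rhd lhd (r - flip r)"

definition factorizable_bidialgebra :: "('f::field \<Rightarrow> 'a::ab_group_add \<Rightarrow> 'a) \<Rightarrow>
    ('a \<Rightarrow> 'a \<Rightarrow> 'a) \<Rightarrow> ('a \<Rightarrow> 'a \<Rightarrow> 'a) \<Rightarrow> ('a, 'f) tensor2 \<Rightarrow> bool" where
  "factorizable_bidialgebra s rhd lhd r \<longleftrightarrow>
     quasi_triangular_bidialgebra s rhd lhd r \<and>
     dual_linear_iso s (map_of_tensor s (r - flip r))"

section \<open>The encoding on pure tensors\<close>

lemma linear_comp_dual:
  assumes "Vector_Spaces.linear s s f" "u \<in> dual_space s"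
  shows "u \<circ> f \<in> dual_space s"
  using assms unfolding dual_space_def by (simp add: Vector_Spaces.linear_compose[of s s f])

lemma linear_vector_space: "Vector_Spaces.linear s s' f \<Longrightarrow> vector_space s"
  unfolding Vector_Spaces.linear_def by blast

lemma linear_iff_field:
  fixes s :: "'f::field \<Rightarrow> 'a::ab_group_add \<Rightarrow> 'a"
  assumes "vector_space s"
  shows "Vector_Spaces.linear s (*) (u :: 'a \<Rightarrow> 'f) \<longleftrightarrow>
    (\<forall>x y. u (x + y) = u x + u y) \<and> (\<forall>c x. u (s c x) = c * u x)"
proof -
  have "vector_space ((*) :: 'f \<Rightarrow> 'f \<Rightarrow> 'f)"
    by unfold_locales (simp_all add: algebra_simps)
  then show ?thesis
    using assms unfolding Vector_Spaces.linear_def module_hom_def module_hom_axioms_def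
      module_iff_vector_space by auto
qed

lemma dual_scaled:
  fixes c :: "'f::field"
  assumes "u \<in> dual_space s"
  shows "(\<lambda>x. u x * c) \<in> dual_space s" "(\<lambda>x. c * u x) \<in> dual_space s"
proof -
  have "vector_space s" using assms by (auto simp: dual_space_def dest: linear_vector_space)
  then show "(\<lambda>x. u x * c) \<in> dual_space s" "(\<lambda>x. c * u x) \<in> dual_space s"
    using assms by (auto simp: dual_space_def linear_iff_field algebra_simps)
qed

lemma tensor_map_pure2:
  assumes "Vector_Spaces.linear s s f" "Vector_Spaces.linear s s g"
  shows "tensor_map s f g (pure2 s x y) = pure2 s (f x) (g y)"
  using assms by (auto simp: tensor_map_def pure2_def restrict2_def fun_eq_iff linear_comp_dual)

lemma flip_pure2: "flip (pure2 s x y) = pure2 s y x"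
  by (auto simp: flip_def pure2_def restrict2_def fun_eq_iff)

lemma coproduct_dual:
  assumes "Vector_Spaces.linear s tensor2_scale d"
  shows "(\<lambda>x. d x u v) \<in> dual_space s"
proof -
  have vs: "vector_space s" and hom: "module_hom s tensor2_scale d"
    using assms unfolding Vector_Spaces.linear_def by auto
  show ?thesis
    using hom vs
    by (auto simp: dual_space_def linear_iff_field module_hom_def module_hom_axioms_def
        tensor2_scale_def)
qed

lemma tensor_left_pure2:
  assumes "Vector_Spaces.linear s tensor2_scale d"
  shows "tensor_left s d (pure2 s x y) = restrict3 s (\<lambda>u v w. d x u v * w y)"
  using coproduct_dual[OF assms]
  by (auto simp: tensor_left_def pure2_def restrict2_def restrict3_def fun_eq_iff)

lemma tensor_right_pure2:
  assumes "Vector_Spaces.linear s tensor2_scale d"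
  shows "tensor_right s d (pure2 s x y) = restrict3 s (\<lambda>u v w. u x * d y v w)"
  using coproduct_dual[OF assms]
  by (auto simp: tensor_right_def pure2_def restrict2_def restrict3_def fun_eq_iff)

lemma sum_fun_apply: "(\<Sum>i\<in>I. f i) x = (\<Sum>i\<in>I. f i x)"
  by (induction I rule: infinite_finite_induct) auto

lemma pure2_sum_apply:
  assumes "u \<in> dual_space s" "v \<in> dual_space s"
  shows "(\<Sum>i\<in>I. pure2 s (a i) (b i)) u v = (\<Sum>i\<in>I. u (a i) * v (b i))"
  using assms by (simp add: sum_fun_apply pure2_def restrict2_def)

lemma functional_on_dual_sum:
  assumes "functional_on_dual s h" "finite I" "vector_space s"
    and "\<And>i. i \<in> I \<Longrightarrow> u i \<in> dual_space s"
  shows "h (\<lambda>x. \<Sum>i\<in>I. c i * u i x) = (\<Sum>i\<in>I. c i * h (u i))"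
    and "(\<lambda>x. \<Sum>i\<in>I. c i * u i x) \<in> dual_space s"
proof -
  have "h (\<lambda>x. \<Sum>i\<in>I. c i * u i x) = (\<Sum>i\<in>I. c i * h (u i)) \<and>
      (\<lambda>x. \<Sum>i\<in>I. c i * u i x) \<in> dual_space s"
    using assms(2,4)
  proof (induction I)
    case empty
    have z: "(\<lambda>x. 0) \<in> dual_space s"
      using assms(3) by (simp add: dual_space_def linear_iff_field)
    have "\<And>c u. u \<in> dual_space s \<Longrightarrow> h (\<lambda>x. c * u x) = c * h u"
      using assms(1) unfolding functional_on_dual_def by blast
    from this[OF z, of 0] z show ?case by simp
  next
    case (insert i I)
    let ?g = "\<lambda>x. \<Sum>i\<in>I. c i * u i x" and ?k = "\<lambda>x. c i * u i x"
    have g: "?g \<in> dual_space s" "h ?g = (\<Sum>i\<in>I. c i * h (u i))" using insert by auto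
    have k: "?k \<in> dual_space s" using insert.prems by (simp add: dual_scaled)
    have hk: "h ?k = c i * h (u i)"
      using assms(1) insert.prems unfolding functional_on_dual_def by blast
    have sum: "(\<lambda>x. \<Sum>i\<in>insert i I. c i * u i x) = ?k + ?g"
      using insert.hyps by (simp add: fun_eq_iff)
    have "h (?k + ?g) = h ?k + h ?g"
      using assms(1) g(1) k unfolding functional_on_dual_def by blast
    moreover have "?k + ?g \<in> dual_space s"
      using g(1) k assms(3) by (simp add: dual_space_def linear_iff_field algebra_simps)
    ultimately show ?case using sum hk g insert.hyps by simp
  qed
  then show "h (\<lambda>x. \<Sum>i\<in>I. c i * u i x) = (\<Sum>i\<in>I. c i * h (u i))"
    and "(\<lambda>x. \<Sum>i\<in>I. c i * u i x) \<in> dual_space s" by auto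
qed

lemma tensor2_space_pure2_sum:
  fixes s :: "'f::field \<Rightarrow> 'a::ab_group_add \<Rightarrow> 'a"
  assumes "finite_dimensional_vector_space s Basis" and t: "t \<in> tensor2_space s"
  shows "\<exists>(n::nat) a b. t = (\<Sum>i<n. pure2 s (a i) (b i))"
proof -
  interpret finite_dimensional_vector_space s Basis by fact
  define e where "e b = (\<lambda>x. representation Basis x b)" for b
  have e: "e b \<in> dual_space s" for b
    unfolding e_def dual_space_def using linear_representation[OF independent_Basis span_Basis] by simp
  have expand: "u = (\<lambda>x. \<Sum>b\<in>Basis. u b * e b x)" if u: "u \<in> dual_space s" for u
  proof
    fix x
    have lin: "u (p + q) = u p + u q" "u (s c p) = c * u p" for p q c
      using u by (auto simp: dual_space_def linear_iff_field[OF vector_space_axioms])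
    have u0: "u 0 = 0" using lin(2)[of 0 0] by simp
    have us: "u (\<Sum>b\<in>I. s (e b x) b) = (\<Sum>b\<in>I. u b * e b x)" for I
      by (induction I rule: infinite_finite_induct) (simp_all add: u0 lin)
    have "x = (\<Sum>b\<in>Basis. s (e b x) b)"
      unfolding e_def using sum_representation_eq[OF independent_Basis, of x Basis] span_Basis finite_Basis
      by simp
    then show "u x = (\<Sum>b\<in>Basis. u b * e b x)" using us by metis
  qed
  define f where "f c = (\<Sum>d\<in>Basis. s (t (e c) (e d)) d)" for c
  have eq: "t = (\<Sum>c\<in>Basis. pure2 s c (f c))"
  proof (intro ext)
    fix u v
    show "t u v = (\<Sum>c\<in>Basis. pure2 s c (f c)) u v"
    proof (cases "u \<in> dual_space s \<and> v \<in> dual_space s")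
      case False
      moreover have "t u v = restrict2 s t u v" using t by (simp add: tensor2_space_def)
      ultimately show ?thesis by (auto simp: sum_fun_apply pure2_def restrict2_def)
    next
      case True
      then have u: "u \<in> dual_space s" and v: "v \<in> dual_space s" by auto
      have tu: "functional_on_dual s (\<lambda>v. t w v)" "functional_on_dual s (\<lambda>v. t v w)"
        if "w \<in> dual_space s" for w
        using t that by (auto simp: tensor2_space_def)
      have "t u v = (\<Sum>c\<in>Basis. u c * t (e c) v)"
        by (subst (1) expand[OF u])
          (rule functional_on_dual_sum(1)[OF tu(2)[OF v] finite_Basis vector_space_axioms e])
      also have "\<dots> = (\<Sum>c\<in>Basis. u c * v (f c))"
      proof (rule sum.cong[OF refl])
        fix c
        have lin: "v (p + q) = v p + v q" "v (s k p) = k * v p" for p q k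
          using v by (auto simp: dual_space_def linear_iff_field[OF vector_space_axioms])
        have v0: "v 0 = 0" using lin(2)[of 0 0] by simp
        have vs: "v (\<Sum>d\<in>I. s (t (e c) (e d)) d) = (\<Sum>d\<in>I. v d * t (e c) (e d))" for I
          by (induction I rule: infinite_finite_induct) (simp_all add: v0 lin)
        have "t (e c) v = (\<Sum>d\<in>Basis. v d * t (e c) (e d))"
          by (subst (1) expand[OF v])
            (rule functional_on_dual_sum(1)[OF tu(1)[OF e] finite_Basis vector_space_axioms e])
        then show "u c * t (e c) v = u c * v (f c)" unfolding f_def vs by simp
      qed
      finally show ?thesis using u v by (simp add: pure2_sum_apply)
    qed
  qed
  obtain g where g: "bij_betw g {..<card Basis} Basis"
    using finite_Basis ex_bij_betw_nat_finite[of Basis] by (auto simp: atLeast0LessThan)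
  have "t = (\<Sum>i<card Basis. pure2 s (g i) (f (g i)))"
    unfolding eq by (rule sum.reindex_bij_betw[OF g, symmetric])
  then show ?thesis by (intro exI)
qed

lemma daybe_lhs_eq:
  fixes s :: "'f::field \<Rightarrow> 'a::ab_group_add \<Rightarrow> 'a"
  assumes m: "bilinear_map s s rhd" "bilinear_map s s lhd"
    and r: "r = (\<Sum>i<n. pure2 s (a i) (b i))"
  shows "daybe_lhs s rhd lhd n a b = restrict3 s (\<lambda>u v w.
      r u (\<lambda>x. r v (\<lambda>y. w (rhd x y)))
    - r (\<lambda>x. r u (\<lambda>y. v (lhd x y))) w
    - r (\<lambda>x. r (\<lambda>y. u (star rhd lhd x y)) w) v)"
proof (intro ext)
  fix u v w
  show "daybe_lhs s rhd lhd n a b u v w = restrict3 s (\<lambda>u v w.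
      r u (\<lambda>x. r v (\<lambda>y. w (rhd x y)))
    - r (\<lambda>x. r u (\<lambda>y. v (lhd x y))) w
    - r (\<lambda>x. r (\<lambda>y. u (star rhd lhd x y)) w) v) u v w"
  proof (cases "u \<in> dual_space s \<and> v \<in> dual_space s \<and> w \<in> dual_space s")
    case False
    then show ?thesis by (auto simp: daybe_lhs_def restrict3_def pure3_def sum_fun_apply)
  next
    case True
    then have u: "u \<in> dual_space s" and v: "v \<in> dual_space s" and w: "w \<in> dual_space s" by auto
    have vs: "vector_space s" using u by (auto simp: dual_space_def dest: linear_vector_space)
    have bl: "m (p + q) z = m p z + m q z" "m z (p + q) = m z p + m z q"
        "m (s c p) z = s c (m p z)" "m z (s c p) = s c (m z p)"
      if "bilinear_map s s m" for m p q z c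
      using that
      by (auto simp: bilinear_map_def Vector_Spaces.linear_def module_hom_def module_hom_axioms_def)
    have lin: "h (p + q) = h p + h q" "h (s c p) = c * h p" if "h \<in> dual_space s" for h p q c
      using that vs by (auto simp: dual_space_def linear_iff_field)
    have "bilinear_map s s (star rhd lhd)"
    proof -
      interpret vector_space s by fact
      show ?thesis
        using vs bl[OF m(1)] bl[OF m(2)]
        by (auto simp: bilinear_map_def star_def Vector_Spaces.linear_def module_hom_def
            module_hom_axioms_def module_iff_vector_space scale_right_diff_distrib)
    qed
    note bls = bl[OF m(1)] bl[OF m(2)] bl[OF this]
    have d: "(\<lambda>y. h (m x y)) \<in> dual_space s" "(\<lambda>x. \<Sum>i\<in>I. c i * h (m x (k i))) \<in> dual_space s"
      if "h \<in> dual_space s" "bilinear_map s s m" for h m x and I :: "nat set" and c k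
      using that vs
      by (auto simp: dual_space_def linear_iff_field bl[OF that(2)] algebra_simps sum.distrib
          sum_distrib_left)
    have ds: "bilinear_map s s (star rhd lhd)" by fact
    have r': "r f g = (\<Sum>i<n. f (a i) * g (b i))"
      if "f \<in> dual_space s" "g \<in> dual_space s" for f g
      unfolding r using that by (rule pure2_sum_apply)
    have 1: "r u (\<lambda>x. r v (\<lambda>y. w (rhd x y))) =
        (\<Sum>i<n. u (a i) * (\<Sum>j<n. v (a j) * w (rhd (b i) (b j))))"
      using u v w by (simp add: r' d(1)[OF _ m(1)] d(2)[OF w m(1)])
    have 2: "r (\<lambda>x. r u (\<lambda>y. v (lhd x y))) w =
        (\<Sum>i<n. (\<Sum>j<n. u (a j) * v (lhd (a i) (b j))) * w (b i))"
      using u v w by (simp add: r' d(1)[OF _ m(2)] d(2)[OF v m(2)])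
    have d3: "(\<lambda>x. \<Sum>j<n. u (star rhd lhd x (a j)) * w (b j)) \<in> dual_space s"
      using d(2)[OF u ds, where c = "\<lambda>j. w (b j)" and k = a and I = "{..<n}"]
      by (simp add: mult.commute)
    have 3: "r (\<lambda>x. r (\<lambda>y. u (star rhd lhd x y)) w) v =
        (\<Sum>i<n. (\<Sum>j<n. u (star rhd lhd (a i) (a j)) * w (b j)) * v (b i))"
      using u v w by (simp add: r' d(1)[OF _ ds] d3)
    show ?thesis
      using u v w unfolding restrict3_def 1 2 3
      by (simp add: daybe_lhs_def pure3_def restrict3_def sum_fun_apply sum_subtractf
          sum_distrib_left sum_distrib_right mult_ac)
  qed
qed

lemma daybe_lhs_unique:
  fixes s :: "'f::field \<Rightarrow> 'a::ab_group_add \<Rightarrow> 'a"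
  assumes "bilinear_map s s rhd" "bilinear_map s s lhd"
    and "(\<Sum>i<n. pure2 s (a i) (b i)) = (\<Sum>i<n'. pure2 s (a' i) (b' i))"
  shows "daybe_lhs s rhd lhd n a b = daybe_lhs s rhd lhd n' a' b'"
  using daybe_lhs_eq[OF assms(1,2) refl, of n a b] daybe_lhs_eq[OF assms(1,2) refl, of n' a' b']
    assms(3) by simp

end

theory Submission
  imports Defs
begin

text \<open>
  The form identifies \<open>A\<^sup>*\<close> with \<open>A\<close>, hence a 2-tensor \<open>t\<close> with the operator \<open>T\<close> on \<open>A\<close> such that
  \<open>\<langle>t, \<phi>(a) \<otimes> \<phi>(b)\<rangle> = \<BB>(b, T a)\<close>. The tensor \<open>r\<close> becomes \<open>P\<close>, the map \<open>f \<otimes> g\<close> becomes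
  \<open>T \<mapsto> g T f\<^sup>*\<close> with \<open>f\<^sup>*\<close> the adjoint of \<open>f\<close>, and invariance of \<open>\<BB>\<close> says that the adjoints of
  multiplications are multiplications. Since \<open>P\<^sup>* = - P - \<lambda>\<close>, the skew part of \<open>r\<close> becomes the scalar
  operator \<open>- \<lambda>\<close>, which gives its invariance and invertibility. The compatibility conditions
  become identities of operators in which \<open>P\<close> enters only as a linear map with this adjoint.
  The coproducts are dual to the products \<open>P a \<diamondop> b + a \<diamondop> P b + \<lambda> a \<diamondop> b\<close>, for which the
  Rota-Baxter identity says that \<open>P\<close> is multiplicative; so these form a dialgebra again. The
  same identity is the DAYBE.
\<close>

lemma linear_iff:
  assumes "vector_space s" "vector_space s'"
  shows "Vector_Spaces.linear s s' f \<longleftrightarrow>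
    (\<forall>x y. f (x + y) = f x + f y) \<and> (\<forall>c x. f (s c x) = s' c (f x))"
  using assms unfolding Vector_Spaces.linear_def module_hom_def module_hom_axioms_def
    module_iff_vector_space by auto

lemma vector_space_tensor2_scale:
  "vector_space (tensor2_scale :: 'f::field \<Rightarrow> ('a, 'f) tensor2 \<Rightarrow> ('a, 'f) tensor2)"
  by unfold_locales (simp_all add: tensor2_scale_def fun_eq_iff algebra_simps)

section \<open>The products, the form and the operator as rewrite rules\<close>

locale skew_Rota_Baxter_Frobenius = finite_dimensional_vector_space s Basis
  for s :: "'f::field \<Rightarrow> 'a::ab_group_add \<Rightarrow> 'a" and Basis :: "'a set" +
  fixes rhd :: "'a \<Rightarrow> 'a \<Rightarrow> 'a" (infixl "\<rhd>" 70)
    and lhd :: "'a \<Rightarrow> 'a \<Rightarrow> 'a" (infixl "\<lhd>" 70)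
    and B :: "'a \<Rightarrow> 'a \<Rightarrow> 'f" and P :: "'a \<Rightarrow> 'a" and lam :: 'f
  assumes Rota_Baxter_Frobenius: "skew_Rota_Baxter_Frobenius_dialgebra s rhd lhd B lam P"
begin

lemma is_dialgebra: "dialgebra s rhd lhd"
  using Rota_Baxter_Frobenius
  unfolding skew_Rota_Baxter_Frobenius_dialgebra_def skew_Frobenius_dialgebra_def by blast

lemma bilinear_rhd: "bilinear_map s s rhd" and bilinear_lhd: "bilinear_map s s lhd"
  using is_dialgebra unfolding dialgebra_def by blast+

lemma linear_P: "Vector_Spaces.linear s s P"
  using Rota_Baxter_Frobenius
  unfolding skew_Rota_Baxter_Frobenius_dialgebra_def Rota_Baxter_operator_def by blast

lemma bilinear_B: "bilinear_map s (*) B"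
  using Rota_Baxter_Frobenius
  unfolding skew_Rota_Baxter_Frobenius_dialgebra_def skew_Frobenius_dialgebra_def by blast

lemma linear_mult:
  "Vector_Spaces.linear s s (Lmul rhd x)" "Vector_Spaces.linear s s (Lmul lhd x)"
  "Vector_Spaces.linear s s (Rmul rhd x)" "Vector_Spaces.linear s s (Rmul lhd x)"
  using bilinear_rhd bilinear_lhd by (simp_all add: bilinear_map_def Lmul_def Rmul_def)

lemmas linear_self_iff = linear_iff[OF vector_space_axioms vector_space_axioms]

lemma mult_add:
  "(x + y) \<rhd> z = x \<rhd> z + y \<rhd> z" "x \<rhd> (y + z) = x \<rhd> y + x \<rhd> z"
  "(x + y) \<lhd> z = x \<lhd> z + y \<lhd> z" "x \<lhd> (y + z) = x \<lhd> y + x \<lhd> z"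
  using linear_mult unfolding linear_self_iff by (simp_all add: Lmul_def Rmul_def)

lemma mult_scale:
  "s c x \<rhd> y = s c (x \<rhd> y)" "x \<rhd> s c y = s c (x \<rhd> y)"
  "s c x \<lhd> y = s c (x \<lhd> y)" "x \<lhd> s c y = s c (x \<lhd> y)"
  using linear_mult unfolding linear_self_iff by (simp_all add: Lmul_def Rmul_def)

lemma P_add: "P (x + y) = P x + P y" and P_scale: "P (s c x) = s c (P x)"
  using linear_P unfolding linear_self_iff by simp_all

lemma B_add: "B (x + y) z = B x z + B y z" "B x (y + z) = B x y + B x z"
  and B_scale: "B (s c x) y = c * B x y" "B x (s c y) = c * B x y"
  using bilinear_B by (simp_all add: bilinear_map_def linear_iff_field[OF vector_space_axioms])

sublocale rhd_left: additive "\<lambda>y. x \<rhd> y" for x by unfold_locales (simp add: mult_add)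
sublocale rhd_right: additive "\<lambda>x. x \<rhd> y" for y by unfold_locales (simp add: mult_add)
sublocale lhd_left: additive "\<lambda>y. x \<lhd> y" for x by unfold_locales (simp add: mult_add)
sublocale lhd_right: additive "\<lambda>x. x \<lhd> y" for y by unfold_locales (simp add: mult_add)
sublocale P: additive P by unfold_locales (simp add: P_add)
sublocale B_left: additive "\<lambda>y. B x y" for x by unfold_locales (simp add: B_add)
sublocale B_right: additive "\<lambda>x. B x y" for y by unfold_locales (simp add: B_add)

lemmas mult_linear = mult_add mult_scale P_add P_scale
  rhd_left.zero rhd_right.zero lhd_left.zero lhd_right.zero P.zero
  rhd_left.diff rhd_right.diff lhd_left.diff lhd_right.diff P.diff
  rhd_left.minus rhd_right.minus lhd_left.minus lhd_right.minus P.minus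

lemmas B_linear = B_add B_scale B_left.diff B_right.diff B_left.minus B_right.minus

text \<open>Oriented as rewrite rules, these leave exactly three shapes of triple products:
  \<open>x \<rhd> (y \<rhd> z)\<close>, \<open>x \<rhd> (y \<lhd> z)\<close> and
  \<open>x \<lhd> (y \<rhd> z)\<close>.\<close>

lemma dialgebra_right_normal:
  "x \<rhd> y \<rhd> z = x \<rhd> (y \<rhd> z)" "x \<lhd> y \<lhd> z = x \<lhd> (y \<rhd> z)" "x \<lhd> (y \<lhd> z) = x \<lhd> (y \<rhd> z)"
  "x \<rhd> y \<lhd> z = x \<rhd> (y \<lhd> z)" "x \<lhd> y \<rhd> z = x \<rhd> (y \<rhd> z)"
proof -
  have lhd: "x \<lhd> y \<lhd> z = x \<lhd> (y \<lhd> z)" "x \<lhd> y \<lhd> z = x \<lhd> (y \<rhd> z)"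
    using is_dialgebra unfolding dialgebra_def by blast+
  then show "x \<lhd> y \<lhd> z = x \<lhd> (y \<rhd> z)" "x \<lhd> (y \<lhd> z) = x \<lhd> (y \<rhd> z)"
    by simp_all
qed (use is_dialgebra in \<open>unfold dialgebra_def, blast+\<close>)

lemma Rota_Baxter:
  "P x \<rhd> P y = P (P x \<rhd> y + x \<rhd> P y + s lam (x \<rhd> y))"
  "P x \<lhd> P y = P (P x \<lhd> y + x \<lhd> P y + s lam (x \<lhd> y))"
  using Rota_Baxter_Frobenius
  unfolding skew_Rota_Baxter_Frobenius_dialgebra_def Rota_Baxter_operator_def by blast+

lemma B_skew: "B x y = - B y x"
  using Rota_Baxter_Frobenius
  unfolding skew_Rota_Baxter_Frobenius_dialgebra_def skew_Frobenius_dialgebra_def by blast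

lemma B_nondegenerate: "(\<And>y. B x y = 0) \<Longrightarrow> x = 0" "(\<And>x. B x y = 0) \<Longrightarrow> y = 0"
  using Rota_Baxter_Frobenius
  unfolding skew_Rota_Baxter_Frobenius_dialgebra_def skew_Frobenius_dialgebra_def
    nondegenerate_form_def by blast+

lemma B_eqI: "x = y" if "\<And>z. B x z = B y z"
  using that B_nondegenerate(1)[of "x - y"] by (simp add: B_linear)

lemma B_eqI': "x = y" if "\<And>z. B z x = B z y"
  using that B_nondegenerate(2)[of "x - y"] by (simp add: B_linear)

lemma B_invariant: "B (x \<rhd> y) z = B x (y \<rhd> z - y \<lhd> z)" "B (x \<lhd> y) z = B x (y \<rhd> z)"
  using Rota_Baxter_Frobenius
  unfolding skew_Rota_Baxter_Frobenius_dialgebra_def skew_Frobenius_dialgebra_def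
    invariant_form_def by blast+

lemma P_adjoint: "B x (P y) = B (- P x - s lam x) y"
proof -
  have "B (P x) y + B x (P y) + lam * B x y = 0"
    using Rota_Baxter_Frobenius unfolding skew_Rota_Baxter_Frobenius_dialgebra_def by blast
  moreover have "B x (P y) = (B (P x) y + B x (P y) + lam * B x y) - B (P x) y - lam * B x y"
    by simp
  ultimately show ?thesis by (simp add: B_linear)
qed

section \<open>Adjoints with respect to the form\<close>

lemma left_mult_adjoint:
  "B a (x \<rhd> y) = B (a \<lhd> x) y" "B a (x \<lhd> y) = B (a \<lhd> x - a \<rhd> x) y"
  by (simp_all add: B_linear B_invariant)

text \<open>Skew-symmetry brings the product into the left argument, where invariance applies; the
  signs of the two swaps cancel.\<close>

lemma right_mult_adjoint:
  "B a (y \<rhd> x) = B (x \<rhd> a - x \<lhd> a) y" "B a (y \<lhd> x) = B (x \<rhd> a) y"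
  using B_skew[of a "y \<rhd> x"] B_skew[of a "y \<lhd> x"] B_skew[of y "x \<rhd> a - x \<lhd> a"]
    B_skew[of y "x \<rhd> a"]
  by (simp_all add: B_invariant)

definition is_adjoint :: "('a \<Rightarrow> 'a) \<Rightarrow> ('a \<Rightarrow> 'a) \<Rightarrow> bool" where
  "is_adjoint f g \<longleftrightarrow> (\<forall>a y. B a (f y) = B (g a) y)"

lemma is_adjoint_id: "is_adjoint id id"
  by (simp add: is_adjoint_def)

lemma is_adjoint_left_mult:
  "is_adjoint (Lmul rhd x) (Rmul lhd x)" "is_adjoint (Lmul lhd x) (- Rmul (star rhd lhd) x)"
  "is_adjoint (Lmul (star rhd lhd) x) (Rmul rhd x)"
  by (simp_all add: is_adjoint_def Lmul_def Rmul_def star_def B_linear left_mult_adjoint)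

lemma is_adjoint_right_mult:
  "is_adjoint (Rmul rhd x) (Lmul (star rhd lhd) x)" "is_adjoint (Rmul lhd x) (Lmul rhd x)"
  "is_adjoint (Rmul (star rhd lhd) x) (- Lmul lhd x)"
  by (simp_all add: is_adjoint_def Lmul_def Rmul_def star_def B_linear right_mult_adjoint)

lemmas is_adjoint_mult = is_adjoint_left_mult is_adjoint_right_mult

section \<open>Identification of the space with its dual\<close>

abbreviation \<phi> :: "'a \<Rightarrow> 'a \<Rightarrow> 'f" where "\<phi> \<equiv> form_map B"

lemma phi_dual [simp]: "\<phi> a \<in> dual_space s"
  by (simp add: dual_space_def linear_iff_field[OF vector_space_axioms] form_map_def B_linear)

lemma phi_apply [simp]: "\<phi> a x = B a x"
  by (simp add: form_map_def)

lemma inj_phi: "inj \<phi>"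
  by (rule injI, rule B_eqI) (simp add: fun_eq_iff)

lemma inv_phi [simp]: "inv \<phi> (\<phi> a) = a"
  by (rule inv_f_f[OF inj_phi])

text \<open>The endomorphism \<open>x \<mapsto> \<Sum>b. \<BB>(x, b) b\<close> stands in for \<open>\<phi>\<close> here, so that finite dimension
  gives surjectivity from injectivity without a dimension theory for \<open>A\<^sup>*\<close>.\<close>

lemma dual_is_phi:
  assumes u: "u \<in> dual_space s"
  obtains a where "u = \<phi> a"
proof -
  define \<psi> where "\<psi> x = (\<Sum>b\<in>Basis. s (B x b) b)" for x
  have combine: "f (\<Sum>b\<in>I. s (c b) b) = (\<Sum>b\<in>I. c b * f b)" if "f \<in> dual_space s"
    for f :: "'a \<Rightarrow> 'f" and I c
  proof -
    have add: "f (p + q) = f p + f q" and scale: "f (s k p) = k * f p" for p q k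
      using that by (auto simp: dual_space_def linear_iff_field[OF vector_space_axioms])
    have "f 0 = 0" using scale[of 0 0] by simp
    then show ?thesis by (induction I rule: infinite_finite_induct) (simp_all add: add scale)
  qed
  have coeff: "representation Basis (\<Sum>b\<in>Basis. s (c b) b) b = c b" if "b \<in> Basis" for c b
  proof -
    have "(\<lambda>x. representation Basis x b) \<in> dual_space s"
      unfolding dual_space_def using linear_representation[OF independent_Basis span_Basis] by simp
    from combine[OF this, of c Basis]
    have "representation Basis (\<Sum>b\<in>Basis. s (c b) b) b = (\<Sum>d\<in>Basis. c d * representation Basis d b)" .
    also have "\<dots> = (\<Sum>d\<in>Basis. if d = b then c d else 0)"
      by (rule sum.cong) (simp_all add: representation_basis[OF independent_Basis])
    finally show ?thesis using that finite_Basis by simp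
  qed
  have lin: "Vector_Spaces.linear s s \<psi>"
    unfolding linear_self_iff \<psi>_def
    by (simp add: B_linear scale_left_distrib sum.distrib scale_sum_right)
  have basis_ext: "f = g"
    if "f \<in> dual_space s" "g \<in> dual_space s" "\<And>b. b \<in> Basis \<Longrightarrow> f b = g b" for f g :: "'a \<Rightarrow> 'f"
  proof
    fix x
    let ?c = "representation Basis x"
    have "x = (\<Sum>b\<in>Basis. s (?c b) b)"
      using sum_representation_eq[OF independent_Basis, of x Basis] finite_Basis by (simp add: span_Basis)
    moreover have "f (\<Sum>b\<in>Basis. s (?c b) b) = g (\<Sum>b\<in>Basis. s (?c b) b)"
      using that by (simp add: combine)
    ultimately show "f x = g x" by simp
  qed
  have "inj \<psi>"
  proof (rule injI)
    fix x y assume "\<psi> x = \<psi> y"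
    then have "\<phi> x b = \<phi> y b" if "b \<in> Basis" for b
      using coeff[OF that, of "B x"] coeff[OF that, of "B y"] by (simp add: \<psi>_def)
    then have "\<phi> x = \<phi> y" by (intro basis_ext) simp_all
    then show "x = y" using inj_phi by (simp add: inj_eq)
  qed
  then have "surj \<psi>" using lin by (rule linear_inj_imp_surj[rotated])
  \<comment> \<open>The target has the values of \<open>u\<close> on the basis as its coordinates,
    so a preimage \<open>a\<close> makes \<open>\<phi> a\<close> and \<open>u\<close> agree on the
    basis.\<close>
  then obtain a where a: "\<psi> a = (\<Sum>b\<in>Basis. s (u b) b)" by (metis surjD)
  have "u b = \<phi> a b" if "b \<in> Basis" for b
    using coeff[OF that, of u] coeff[OF that, of "B a"] a by (simp add: \<psi>_def)
  then have "u = \<phi> a" using u by (intro basis_ext) simp_all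
  then show thesis by (rule that)
qed

section \<open>Operators as 2-tensors\<close>

text \<open>Written so that the tensor \<open>r\<close> of the theorem is \<open>op_tensor P\<close>
  by unfolding.\<close>

definition op_tensor :: "('a \<Rightarrow> 'a) \<Rightarrow> ('a, 'f) tensor2" where
  "op_tensor T = tensor_of_map s (T \<circ> inv \<phi>)"

lemma op_tensor_apply [simp]: "op_tensor T (\<phi> a) (\<phi> b) = B b (T a)"
  by (simp add: op_tensor_def tensor_of_map_def restrict2_def)

lemma op_tensor_outside: "u \<notin> dual_space s \<or> v \<notin> dual_space s \<Longrightarrow> op_tensor T u v = 0"
  by (auto simp: op_tensor_def tensor_of_map_def restrict2_def)

text \<open>Every functional is some \<open>\<phi> a\<close>, so a tensor that is 0 off the dual is
  determined by its values on these.\<close>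

lemma op_tensor_eqI:
  assumes "restrict2 s t = t" "\<And>a b. t (\<phi> a) (\<phi> b) = B b (T a)"
  shows "t = op_tensor T"
proof (intro ext)
  fix u v
  show "t u v = op_tensor T u v"
  proof (cases "u \<in> dual_space s \<and> v \<in> dual_space s")
    case True
    then show ?thesis using assms(2) by (metis dual_is_phi op_tensor_apply)
  next
    case False
    then have "restrict2 s t u v = op_tensor T u v"
      by (auto simp: restrict2_def op_tensor_outside)
    then show ?thesis by (simp add: assms(1))
  qed
qed

lemma restrict2_op_tensor: "restrict2 s (op_tensor T) = op_tensor T"
  by (auto simp: restrict2_def op_tensor_outside fun_eq_iff)

lemma op_tensor_add: "op_tensor T + op_tensor U = op_tensor (\<lambda>a. T a + U a)"
  and op_tensor_diff: "op_tensor T - op_tensor U = op_tensor (\<lambda>a. T a - U a)"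
  by (rule op_tensor_eqI; force simp: B_linear restrict2_def op_tensor_outside)+

lemma op_tensor_zero: "op_tensor (\<lambda>_. 0) = 0"
  by (rule op_tensor_eqI[symmetric]) (auto simp: restrict2_def B_left.zero fun_eq_iff)

lemma phi_comp_adjoint: "is_adjoint f g \<Longrightarrow> \<phi> a \<circ> f = \<phi> (g a)"
  by (simp add: is_adjoint_def fun_eq_iff)

text \<open>Precomposing with \<open>f\<close> and \<open>g\<close> turns \<open>\<phi> a\<close>
  and \<open>\<phi> b\<close> into \<open>\<phi> (f' a)\<close> and \<open>\<phi> (g' b)\<close>;
  moving \<open>g'\<close> back across \<open>B\<close> leaves \<open>g\<close> in front of
  \<open>T\<close>.\<close>

lemma tensor_map_op_tensor:
  assumes "is_adjoint f f'" "is_adjoint g g'"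
  shows "tensor_map s f g (op_tensor T) = op_tensor (\<lambda>a. g (T (f' a)))"
proof (rule op_tensor_eqI)
  show "tensor_map s f g (op_tensor T) (\<phi> a) (\<phi> b) = B b (g (T (f' a)))" for a b
    using assms(2)
    by (simp add: tensor_map_def restrict2_def phi_comp_adjoint[OF assms(1)]
        phi_comp_adjoint[OF assms(2)] is_adjoint_def)
qed (auto simp: tensor_map_def restrict2_def fun_eq_iff)

lemmas tensor_map_mult =
  is_adjoint_mult[THEN tensor_map_op_tensor[OF _ is_adjoint_id]]
  is_adjoint_mult[THEN tensor_map_op_tensor[OF is_adjoint_id]]

text \<open>The hypothesis says that \<open>U\<close> is minus the adjoint of \<open>T\<close>, the
  sign coming from skew-symmetry.\<close>

lemma flip_op_tensor:
  assumes "\<And>a b. B a (T b) = B b (U a)"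
  shows "flip (op_tensor T) = op_tensor U"
  by (rule op_tensor_eqI)
    (auto simp: assms flip_def restrict2_def op_tensor_outside fun_eq_iff)

lemma op_tensor_in_space:
  assumes "Vector_Spaces.linear s s T"
  shows "op_tensor T \<in> tensor2_space s"
proof -
  have T: "T (a + b) = T a + T b" "T (s c a) = s c (T a)" for a b c
    using assms unfolding linear_self_iff by auto
  have phi: "\<phi> a + \<phi> b = \<phi> (a + b)" "(\<lambda>x. c * B a x) = \<phi> (s c a)" for a b c
    by (simp_all add: fun_eq_iff B_linear)
  have "functional_on_dual s (op_tensor T (\<phi> a))" for a
    unfolding functional_on_dual_def
    by (auto elim!: dual_is_phi simp: phi B_linear)
  moreover have "functional_on_dual s (\<lambda>u. op_tensor T u (\<phi> b))" for b
    unfolding functional_on_dual_def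
    by (auto elim!: dual_is_phi simp: phi T B_linear)
  ultimately show ?thesis
    unfolding tensor2_space_def by (auto simp: restrict2_op_tensor elim!: dual_is_phi)
qed

text \<open>Testing against all \<open>\<phi> b\<close> determines the value, by
  nondegeneracy.\<close>

lemma map_of_op_tensor: "map_of_tensor s (op_tensor T) (\<phi> a) = T a"
  unfolding map_of_tensor_def
proof (rule the_equality)
  show "\<forall>v\<in>dual_space s. v (T a) = op_tensor T (\<phi> a) v"
    by (auto elim!: dual_is_phi)
next
  fix x assume *: "\<forall>v\<in>dual_space s. v x = op_tensor T (\<phi> a) v"
  show "x = T a"
    using *[rule_format, OF phi_dual] by (intro B_eqI') simp
qed

lemma linear_op_tensor:
  assumes "\<And>x y a. D (x + y) a = D x a + D y a" "\<And>c x a. D (s c x) a = s c (D x a)"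
  shows "Vector_Spaces.linear s tensor2_scale (\<lambda>x. op_tensor (D x))"
proof -
  have "op_tensor (\<lambda>a. s c (T a)) = tensor2_scale c (op_tensor T)" for c T
    by (rule op_tensor_eqI[symmetric])
      (auto simp: tensor2_scale_def B_linear restrict2_def op_tensor_outside fun_eq_iff)
  moreover have "D (x + y) = (\<lambda>a. D x a + D y a)" "D (s c x) = (\<lambda>a. s c (D x a))" for x y c
    by (simp_all add: assms fun_eq_iff)
  ultimately show ?thesis
    unfolding linear_iff[OF vector_space_axioms vector_space_tensor2_scale]
    by (simp add: op_tensor_add)
qed

section \<open>Iterated coproducts as forms in three vectors\<close>

definition form3 :: "('a \<Rightarrow> 'a \<Rightarrow> 'a \<Rightarrow> 'f) \<Rightarrow> ('a, 'f) tensor3" where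
  "form3 F = restrict3 s (\<lambda>u v w. F (inv \<phi> u) (inv \<phi> v) (inv \<phi> w))"

lemma restrict3_eq_form3:
  assumes "\<And>a b c. t (\<phi> a) (\<phi> b) (\<phi> c) = F a b c"
  shows "restrict3 s t = form3 F"
  by (auto simp: restrict3_def form3_def fun_eq_iff assms elim!: dual_is_phi)

text \<open>The products \<open>m\<close> and \<open>m'\<close> are dual to the coproducts given by
  \<open>D\<close> and \<open>D'\<close>, so the two iterated coproducts are dual to the two
  bracketings of three factors.\<close>

lemma tensor_left_right_op_tensor:
  assumes "\<And>x a b. B b (D x a) = B (m a b) x" "\<And>x a b. B b (D' x a) = B (m' a b) x"
  shows "tensor_left s (\<lambda>x. op_tensor (D x)) (op_tensor (D' x)) = form3 (\<lambda>a b c. B (m' (m a b) c) x)"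
    and "tensor_right s (\<lambda>x. op_tensor (D x)) (op_tensor (D' x)) = form3 (\<lambda>a b c. B (m' a (m b c)) x)"
proof -
  have *: "(\<lambda>x. op_tensor (D x) (\<phi> a) (\<phi> b)) = \<phi> (m a b)" for a b
    by (simp add: assms fun_eq_iff)
  show "tensor_left s (\<lambda>x. op_tensor (D x)) (op_tensor (D' x)) = form3 (\<lambda>a b c. B (m' (m a b) c) x)"
    "tensor_right s (\<lambda>x. op_tensor (D x)) (op_tensor (D' x)) = form3 (\<lambda>a b c. B (m' a (m b c)) x)"
    unfolding tensor_left_def tensor_right_def by (rule restrict3_eq_form3, subst *, simp add: assms)+
qed

section \<open>The coproducts and their dual products\<close>

text \<open>The operators of the two coproducts are commutators: \<open>D_rhd x\<close> is
  \<open>[Lmul lhd x, P]\<close> and \<open>D_lhd x\<close> is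
  \<open>[P, Lmul (star rhd lhd) x]\<close>.\<close>

definition D_rhd :: "'a \<Rightarrow> 'a \<Rightarrow> 'a" where "D_rhd x a = x \<lhd> P a - P (x \<lhd> a)"
definition D_lhd :: "'a \<Rightarrow> 'a \<Rightarrow> 'a" where
  "D_lhd x a = P (x \<rhd> a) - P (x \<lhd> a) - x \<rhd> P a + x \<lhd> P a"

lemma coproduct_rhd_op_tensor:
  "coproduct_rhd s rhd lhd (op_tensor P) = (\<lambda>x. op_tensor (D_rhd x))"
proof
  fix x
  have "D_rhd x = (\<lambda>a. P ((- Lmul lhd x) a) + Lmul lhd x (P (id a)))"
    by (simp add: fun_eq_iff D_rhd_def Lmul_def mult_linear)
  then show "coproduct_rhd s rhd lhd (op_tensor P) x = op_tensor (D_rhd x)"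
    by (simp add: coproduct_rhd_def tensor_map_mult op_tensor_add)
qed

lemma coproduct_lhd_op_tensor:
  "coproduct_lhd s rhd lhd (op_tensor P) = (\<lambda>x. op_tensor (D_lhd x))"
proof
  fix x
  have "D_lhd x = (\<lambda>a. P (Lmul (star rhd lhd) x a) - Lmul (star rhd lhd) x (P (id a)))"
    by (simp add: fun_eq_iff D_lhd_def Lmul_def star_def mult_linear)
  then show "coproduct_lhd s rhd lhd (op_tensor P) x = op_tensor (D_lhd x)"
    by (simp add: coproduct_lhd_def tensor_map_mult op_tensor_diff)
qed

text \<open>The descendent products of a Rota-Baxter operator of weight \<open>lam\<close>.\<close>

definition desc_rhd :: "'a \<Rightarrow> 'a \<Rightarrow> 'a" where
  "desc_rhd a b = P a \<rhd> b + a \<rhd> P b + s lam (a \<rhd> b)"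
definition desc_lhd :: "'a \<Rightarrow> 'a \<Rightarrow> 'a" where
  "desc_lhd a b = P a \<lhd> b + a \<lhd> P b + s lam (a \<lhd> b)"

lemma P_desc: "P (desc_rhd a b) = P a \<rhd> P b" "P (desc_lhd a b) = P a \<lhd> P b"
  by (simp_all add: desc_rhd_def desc_lhd_def Rota_Baxter)

text \<open>Since \<open>P\<close> is multiplicative from the descendent products to the original
  ones, each side expands into seven triple products with \<open>P\<close> on a proper subset of the
  factors; these match one by one by the dialgebra axioms.\<close>

lemma desc_dialgebra:
  "desc_rhd (desc_rhd a b) c = desc_rhd a (desc_rhd b c)"
  "desc_lhd (desc_lhd a b) c = desc_lhd a (desc_lhd b c)"
  "desc_lhd a (desc_lhd b c) = desc_lhd a (desc_rhd b c)"
  "desc_lhd (desc_rhd a b) c = desc_rhd a (desc_lhd b c)"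
  "desc_rhd (desc_lhd a b) c = desc_rhd (desc_rhd a b) c"
proof -
  \<comment> \<open>The instances used below open only the outer product, so that
    \<open>P_desc\<close> can rewrite \<open>P\<close> of the inner one before that is opened
    too.\<close>
  have expand: "desc_rhd x y = P x \<rhd> y + x \<rhd> P y + s lam (x \<rhd> y)"
    "desc_lhd x y = P x \<lhd> y + x \<lhd> P y + s lam (x \<lhd> y)" for x y
    by (simp_all add: desc_rhd_def desc_lhd_def)
  show "desc_rhd (desc_rhd a b) c = desc_rhd a (desc_rhd b c)"
    "desc_lhd (desc_lhd a b) c = desc_lhd a (desc_lhd b c)"
    "desc_lhd a (desc_lhd b c) = desc_lhd a (desc_rhd b c)"
    "desc_lhd (desc_rhd a b) c = desc_rhd a (desc_lhd b c)"
    "desc_rhd (desc_lhd a b) c = desc_rhd (desc_rhd a b) c"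
    unfolding expand[of "desc_rhd _ _"] expand[of "desc_lhd _ _"] expand[of _ "desc_rhd _ _"]
      expand[of _ "desc_lhd _ _"] P_desc
    by (simp_all add: desc_rhd_def desc_lhd_def mult_add mult_scale dialgebra_right_normal
        scale_right_distrib add_ac)
qed

text \<open>Right multiplications and \<open>P\<close> are moved across \<open>B\<close> until
  \<open>x\<close> stands alone; the weight term of the descendent product comes from the adjoint
  \<open>- P - lam\<close>.\<close>

lemma D_dual: "B b (D_rhd x a) = B (desc_rhd a b) x" "B b (D_lhd x a) = B (desc_lhd a b) x"
  by (simp_all add: D_rhd_def D_lhd_def desc_rhd_def desc_lhd_def B_linear P_adjoint right_mult_adjoint
      mult_linear algebra_simps)

lemma linear_D: "Vector_Spaces.linear s s (D_rhd x)" "Vector_Spaces.linear s s (D_lhd x)"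
  unfolding linear_self_iff
  by (simp_all add: D_rhd_def D_lhd_def mult_linear scale_right_distrib scale_right_diff_distrib)

text \<open>Through \<open>D_dual\<close> the five coalgebra identities become those of
  \<open>desc_dialgebra\<close>.\<close>

lemma codialgebra_D: "codialgebra s (\<lambda>x. op_tensor (D_rhd x)) (\<lambda>x. op_tensor (D_lhd x))"
proof -
  have "Vector_Spaces.linear s tensor2_scale (\<lambda>x. op_tensor (D_rhd x))"
    "Vector_Spaces.linear s tensor2_scale (\<lambda>x. op_tensor (D_lhd x))"
    by (rule linear_op_tensor;
        simp add: D_rhd_def D_lhd_def mult_linear scale_right_distrib scale_right_diff_distrib)+
  then show ?thesis
    unfolding codialgebra_def
    by (simp add: op_tensor_in_space linear_D desc_dialgebra
        tensor_left_right_op_tensor[of D_rhd desc_rhd D_rhd desc_rhd, OF D_dual(1) D_dual(1)]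
        tensor_left_right_op_tensor[of D_rhd desc_rhd D_lhd desc_lhd, OF D_dual(1) D_dual(2)]
        tensor_left_right_op_tensor[of D_lhd desc_lhd D_rhd desc_rhd, OF D_dual(2) D_dual(1)]
        tensor_left_right_op_tensor[of D_lhd desc_lhd D_lhd desc_lhd, OF D_dual(2) D_dual(2)])
qed

section \<open>Flipped coproducts and the compatibility conditions\<close>

text \<open>The result is the commutator \<open>[Rmul (star rhd lhd) x, P]\<close>: on taking minus
  the adjoint of a commutator with \<open>P\<close>, the scalar part of \<open>- P - lam\<close>
  drops out. The flips of \<open>D_lhd\<close> and of the difference coproduct arise in the same
  way.\<close>

lemma flip_D_rhd: "flip (op_tensor (D_rhd x)) = op_tensor (\<lambda>a. P a \<rhd> x - P a \<lhd> x - P (a \<rhd> x) + P (a \<lhd> x))"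
proof (rule flip_op_tensor)
  fix a b
  show "B a (D_rhd x b) = B b (P a \<rhd> x - P a \<lhd> x - P (a \<rhd> x) + P (a \<lhd> x))"
    unfolding B_skew[of b]
    by (simp add: D_rhd_def B_linear P_adjoint left_mult_adjoint mult_linear algebra_simps)
qed

lemma flip_D_lhd: "flip (op_tensor (D_lhd x)) = op_tensor (\<lambda>a. P a \<rhd> x - P (a \<rhd> x))"
proof (rule flip_op_tensor)
  fix a b
  show "B a (D_lhd x b) = B b (P a \<rhd> x - P (a \<rhd> x))"
    unfolding B_skew[of b]
    by (simp add: D_lhd_def B_linear P_adjoint left_mult_adjoint mult_linear algebra_simps)
qed

lemma coproduct_star_op_tensor:
  "(\<lambda>x. op_tensor (D_rhd x)) - (\<lambda>x. op_tensor (D_lhd x)) =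
    (\<lambda>x. op_tensor (\<lambda>a. x \<rhd> P a - P (x \<rhd> a)))"
proof
  fix x
  have "(\<lambda>a. D_rhd x a - D_lhd x a) = (\<lambda>a. x \<rhd> P a - P (x \<rhd> a))"
    by (simp add: D_rhd_def D_lhd_def)
  then show "((\<lambda>x. op_tensor (D_rhd x)) - (\<lambda>x. op_tensor (D_lhd x))) x =
      op_tensor (\<lambda>a. x \<rhd> P a - P (x \<rhd> a))"
    by (simp add: op_tensor_diff)
qed

lemma flip_D_star:
  "flip (op_tensor (\<lambda>a. x \<rhd> P a - P (x \<rhd> a))) = op_tensor (\<lambda>a. P (a \<lhd> x) - P a \<lhd> x)"
proof (rule flip_op_tensor)
  fix a b
  show "B a (x \<rhd> P b - P (x \<rhd> b)) = B b (P (a \<lhd> x) - P a \<lhd> x)"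
    unfolding B_skew[of b]
    by (simp add: B_linear P_adjoint left_mult_adjoint mult_linear algebra_simps)
qed

text \<open>In each of the nine compatibilities every term contains \<open>P\<close> exactly once,
  and the two operators agree after expansion and right-bracketing of the triple products.\<close>

lemma bidialgebra_D: "bidialgebra s rhd lhd (\<lambda>x. op_tensor (D_rhd x)) (\<lambda>x. op_tensor (D_lhd x))"
  unfolding bidialgebra_def Let_def coproduct_star_op_tensor flip_D_rhd flip_D_lhd flip_D_star
    tensor_map_mult op_tensor_add op_tensor_diff
  by (intro conjI allI is_dialgebra codialgebra_D; rule arg_cong[of _ _ op_tensor]; rule ext)
    (simp_all add: D_rhd_def D_lhd_def Lmul_def Rmul_def star_def mult_linear dialgebra_right_normal
      algebra_simps)

section \<open>The skew part, the Yang-Baxter equation and factorizability\<close>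

lemma flip_P: "op_tensor P - flip (op_tensor P) = op_tensor (\<lambda>a. - s lam a)"
proof -
  have "flip (op_tensor P) = op_tensor (\<lambda>a. P a + s lam a)"
    by (rule flip_op_tensor) (simp add: B_skew[of b "_ + _" for b] P_adjoint B_linear)
  then show ?thesis by (simp add: op_tensor_diff)
qed

text \<open>For the operator of a tensor, invariance means commuting with \<open>Lmul lhd x\<close>
  and \<open>Lmul (star rhd lhd) x\<close>, which a scalar operator does.\<close>

lemma invariant_skew_part: "invariant_tensor s rhd lhd (op_tensor P - flip (op_tensor P))"
  unfolding invariant_tensor_def flip_P tensor_map_mult op_tensor_add op_tensor_diff
  by (simp add: Lmul_def star_def mult_linear op_tensor_zero scale_right_diff_distrib)

text \<open>At \<open>\<phi> a\<close>, \<open>\<phi> b\<close>, \<open>\<phi> c\<close> the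
  equation is the Rota-Baxter identity for \<open>\<rhd>\<close> at \<open>a\<close> and
  \<open>b\<close>, paired with \<open>c\<close>. The third term supplies both
  \<open>P (a \<rhd> P b)\<close> and the weight term.\<close>

lemma solves_daybe_P: "solves_daybe s rhd lhd (op_tensor P)"
proof -
  obtain n :: nat and a b where r: "op_tensor P = (\<Sum>i<n. pure2 s (a i) (b i))"
    using tensor2_space_pure2_sum[OF finite_dimensional_vector_space_axioms
        op_tensor_in_space[OF linear_P]] by blast
  have "daybe_lhs s rhd lhd n a b = form3 (\<lambda>a b c. 0)"
    unfolding daybe_lhs_eq[OF bilinear_rhd bilinear_lhd r]
  proof (rule restrict3_eq_form3)
    fix a b c
    \<comment> \<open>In each of the three terms the nested functionals are brought into the form
      \<open>\<phi> _\<close> from the inside out, so that \<open>op_tensor_apply\<close> evaluates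
      every contraction.\<close>
    have 1: "(\<lambda>y. \<phi> c (x \<rhd> y)) = \<phi> (c \<lhd> x)"
      "(\<lambda>x. B (c \<lhd> x) (P b)) = \<phi> (P b \<rhd> c - P b \<lhd> c)" for x
      by (simp_all add: fun_eq_iff flip: right_mult_adjoint left_mult_adjoint)
    have 2: "(\<lambda>y. \<phi> b (x \<lhd> y)) = \<phi> (b \<lhd> x - b \<rhd> x)"
      "(\<lambda>x. B (b \<lhd> x - b \<rhd> x) (P a)) = \<phi> (P a \<rhd> b)" for x
      by (simp_all add: fun_eq_iff flip: right_mult_adjoint left_mult_adjoint)
    have 3: "(\<lambda>y. \<phi> a (star rhd lhd x y)) = \<phi> (a \<rhd> x)"
      "(\<lambda>x. B c (P (a \<rhd> x))) = \<phi> ((- P c - s lam c) \<lhd> a)" for x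
      by (simp add: fun_eq_iff star_def B_invariant)
        (simp add: fun_eq_iff P_adjoint left_mult_adjoint)
    have "B c (P a \<rhd> P b) - B c (P (P a \<rhd> b)) - B b (P ((- P c - s lam c) \<lhd> a)) = 0"
      unfolding B_skew[of b] Rota_Baxter(1)
      by (simp add: P_add P_scale B_linear P_adjoint left_mult_adjoint mult_linear algebra_simps)
    then show "op_tensor P (\<phi> a) (\<lambda>x. op_tensor P (\<phi> b) (\<lambda>y. \<phi> c (x \<rhd> y))) -
        op_tensor P (\<lambda>x. op_tensor P (\<phi> a) (\<lambda>y. \<phi> b (x \<lhd> y))) (\<phi> c) -
        op_tensor P (\<lambda>x. op_tensor P (\<lambda>y. \<phi> a (star rhd lhd x y)) (\<phi> c)) (\<phi> b) = 0"
      by (simp only: 1 2 3 op_tensor_apply right_mult_adjoint(1))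
  qed
  also have "\<dots> = 0" by (simp add: form3_def restrict3_def fun_eq_iff)
  finally show ?thesis unfolding solves_daybe_def using r by blast
qed

lemma dual_linear_iso_skew_part:
  assumes "lam \<noteq> 0"
  shows "dual_linear_iso s (map_of_tensor s (op_tensor P - flip (op_tensor P)))"
proof -
  let ?T = "map_of_tensor s (op_tensor (\<lambda>a. - s lam a))"
  have phi: "\<phi> a + \<phi> b = \<phi> (a + b)" "(\<lambda>x. c * B a x) = \<phi> (s c a)" for a b c
    by (simp_all add: fun_eq_iff B_linear)
  \<comment> \<open>The map sends \<open>\<phi> a\<close> to \<open>- lam\<close> times
    \<open>a\<close>, hence the inverse divides by \<open>- lam\<close> and applies
    \<open>\<phi>\<close>.\<close>
  have "bij_betw ?T (dual_space s) UNIV"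
  using assms by (intro bij_betw_byWitness[where f' = "\<lambda>x. \<phi> (- s (inverse lam) x)"])
      (auto elim!: dual_is_phi simp: map_of_op_tensor)
  then show ?thesis
    unfolding flip_P dual_linear_iso_def
    by (auto elim!: dual_is_phi simp: phi map_of_op_tensor scale_right_distrib mult.commute)
qed

end

theorem theorem4p26:
  fixes s :: "'f::field_char_0 \<Rightarrow> 'a::ab_group_add \<Rightarrow> 'a"
    and Basis :: "'a set"
    and rhd lhd :: "'a \<Rightarrow> 'a \<Rightarrow> 'a"
    and B :: "'a \<Rightarrow> 'a \<Rightarrow> 'f"
    and P :: "'a \<Rightarrow> 'a"
    and lam :: 'f
    and r :: "('a, 'f) tensor2"
  assumes "finite_dimensional_vector_space s Basis"
    and "skew_Rota_Baxter_Frobenius_dialgebra s rhd lhd B lam P"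
    and "lam \<noteq> 0"
    and "r = tensor_of_map s (P \<circ> inv (form_map B))"
  shows "factorizable_bidialgebra s rhd lhd r"
proof -
  interpret skew_Rota_Baxter_Frobenius s Basis rhd lhd B P lam
    using assms(1,2) by (simp add: skew_Rota_Baxter_Frobenius_def skew_Rota_Baxter_Frobenius_axioms_def)
  have r: "r = op_tensor P" by (simp add: assms(4) op_tensor_def)
  show ?thesis
    unfolding factorizable_bidialgebra_def quasi_triangular_bidialgebra_def r
      coproduct_rhd_op_tensor coproduct_lhd_op_tensor
    using op_tensor_in_space[OF linear_P] bidialgebra_D solves_daybe_P invariant_skew_part
      dual_linear_iso_skew_part[OF assms(3)] by blast
qed

end
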